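(* Let $1\le p<\infty$. Then there is a function $f\in V_p[V_p]$ such that $f\notin H_p^{(2)}$.
   Context: Functions are real-valued. For a 1-periodic function $h$ on $\mathbb{R}$, $v_p(h)=\sup_\Pi\big(\sum_{k=0}^{n-1}|h(x_{k+1})-h(x_k)|^p\big)^{1/p}$, the supremum over all partitions $\Pi=\{x_0<x_1<\dots<x_n=x_0+1\}$; $h\in V_p$ means $v_p(h)<\infty$. For a function $f(x,y)$ on $\mathbb{R}^2$, 1-periodic in both variables, $$v_p^{(2)}(f)=\sup_{\mathcal N}\Big(\sum_{i=0}^{m-1}\sum_{j=0}^{n-1}|f(x_{i+1},y_{j+1})-f(x_{i+1},y_j)-f(x_i,y_{j+1})+f(x_i,y_j)|^p\Big)^{1/p},$$ the supremum over all nets $\mathcal N=\{(x_i,y_j):0\le i\le m,\,0\le j\le n\}$ with $x_0<x_1<\dots<x_m=x_0+1$ and $y_0<y_1<\dots<y_n=y_0+1$. The space $H_p^{(2)}$ consists of all functions $f$, 1-periodic in both variables, such that $v_p^{(2)}(f)<\infty$ and, for every $x\in\mathbb{R}$ and every $y\in\mathbb{R}$, the sections $f(x,\cdot)$ and $f(\cdot,y)$ belong to $V_p$. Put $\varphi_p[f](x)=v_p(f(x,\cdot))$ and $\psi_p[f](y)=v_p(f(\cdot,y))$. The class $V_p[V_p]$ consists of all functions $f$, 1-periodic in both variables, for which (with $\varphi_p[f]$ and $\psi_p[f]$ finite everywhere) $v_p(\varphi_p[f])+v_p(\psi_p[f])<\infty$. *)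

theory Defs
  imports "HOL-Analysis.Analysis"
begin

definition periodic1 :: "(real \<Rightarrow> real) \<Rightarrow> bool" where
  "periodic1 h \<longleftrightarrow> (\<forall>x. h (x + 1) = h x)"

definition periodic2 :: "(real \<Rightarrow> real \<Rightarrow> real) \<Rightarrow> bool" where
  "periodic2 f \<longleftrightarrow> (\<forall>x y. f (x + 1) y = f x y \<and> f x (y + 1) = f x y)"

text \<open>Only the values \<open>x 0, \<dots>, x n\<close> matter; \<open>n \<ge> 1\<close> follows from \<open>x n = x 0 + 1\<close>.\<close>

definition period_partition :: "nat \<Rightarrow> (nat \<Rightarrow> real) \<Rightarrow> bool" where
  "period_partition n x \<longleftrightarrow> (\<forall>k<n. x k < x (Suc k)) \<and> x n = x 0 + 1"

text \<open>The variations take values in \<^typ>\<open>ennreal\<close>, so that an unbounded family of sums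
  has supremum \<open>\<infinity>\<close>.\<close>

definition p_var :: "real \<Rightarrow> (real \<Rightarrow> real) \<Rightarrow> ennreal" where
  "p_var p h = (SUP (n, x) \<in> {(n, x). period_partition n x}.
     ennreal ((\<Sum>k<n. \<bar>h (x (Suc k)) - h (x k)\<bar> powr p) powr (1 / p)))"

definition V_space :: "real \<Rightarrow> (real \<Rightarrow> real) set" where
  "V_space p = {h. periodic1 h \<and> p_var p h < \<infinity>}"

definition p_var2 :: "real \<Rightarrow> (real \<Rightarrow> real \<Rightarrow> real) \<Rightarrow> ennreal" where
  "p_var2 p f = (SUP (m, x, n, y) \<in> {(m, x, n, y). period_partition m x \<and> period_partition n y}.
     ennreal ((\<Sum>i<m. \<Sum>j<n.
       \<bar>f (x (Suc i)) (y (Suc j)) - f (x (Suc i)) (y j) - f (x i) (y (Suc j)) + f (x i) (y j)\<bar> powr p)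
       powr (1 / p)))"

definition H2_space :: "real \<Rightarrow> (real \<Rightarrow> real \<Rightarrow> real) set" where
  "H2_space p = {f. periodic2 f \<and> p_var2 p f < \<infinity> \<and>
     (\<forall>x. (\<lambda>y. f x y) \<in> V_space p) \<and> (\<forall>y. (\<lambda>x. f x y) \<in> V_space p)}"

text \<open>The conversion \<^const>\<open>enn2real\<close> sends \<open>\<infinity>\<close> to \<open>0\<close>; below, \<open>phi_var\<close> and \<open>psi_var\<close> are used
  only together with the requirement that all section variations are finite.\<close>

definition phi_var :: "real \<Rightarrow> (real \<Rightarrow> real \<Rightarrow> real) \<Rightarrow> real \<Rightarrow> real" where
  "phi_var p f x = enn2real (p_var p (\<lambda>y. f x y))"

definition psi_var :: "real \<Rightarrow> (real \<Rightarrow> real \<Rightarrow> real) \<Rightarrow> real \<Rightarrow> real" where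
  "psi_var p f y = enn2real (p_var p (\<lambda>x. f x y))"

definition VV_space :: "real \<Rightarrow> (real \<Rightarrow> real \<Rightarrow> real) set" where
  "VV_space p = {f. periodic2 f \<and>
     (\<forall>x. p_var p (\<lambda>y. f x y) < \<infinity>) \<and> (\<forall>y. p_var p (\<lambda>x. f x y) < \<infinity>) \<and>
     p_var p (phi_var p f) + p_var p (psi_var p f) < \<infinity>}"

end

theory Submission
  imports Defs
begin

text \<open>The example is the indicator function of the diagonal of the torus, \<open>f x y = 1\<close> if
  \<open>x - y\<close> is an integer and \<open>f x y = 0\<close> otherwise. Every section is a translate of one and the
  same function, the indicator of \<open>\<int>\<close>. This has finite \<open>p\<close>-variation, because a partition
  of a period sees at most one spike; and since the variation is invariant under translation,
  the two functions of section variations are constant, hence have variation zero. On the other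
  hand the mixed second differences detect each corner of a net that lies on the diagonal: in the
  uniform \<open>N \<times> N\<close> net all \<open>N\<close> diagonal cells have mixed difference \<open>2\<close>, so the two-dimensional
  variation is at least \<open>N powr (1 / p)\<close> for every \<open>N\<close>.\<close>

lemma period_partition_translate:
  "period_partition n x \<Longrightarrow> period_partition n (\<lambda>k. x k + c)"
  by (simp add: period_partition_def)

lemma p_var_translate_le: "p_var p (\<lambda>y. h (y + c)) \<le> p_var p h"
  unfolding p_var_def
proof (intro SUP_least, clarify)
  fix n x assume "period_partition n x"
  then show "ennreal ((\<Sum>k<n. \<bar>h (x (Suc k) + c) - h (x k + c)\<bar> powr p) powr (1 / p))
      \<le> (SUP (n, x) \<in> {(n, x). period_partition n x}.
           ennreal ((\<Sum>k<n. \<bar>h (x (Suc k)) - h (x k)\<bar> powr p) powr (1 / p)))"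
    by (intro SUP_upper2[of "(n, \<lambda>k. x k + c)"]) (auto simp: period_partition_translate)
qed

lemma p_var_translate: "p_var p (\<lambda>y. h (y + c)) = p_var p h"
proof (rule antisym[OF p_var_translate_le])
  show "p_var p h \<le> p_var p (\<lambda>y. h (y + c))"
    using p_var_translate_le[of p "\<lambda>y. h (y + c)" "- c"] by simp
qed

lemma p_var_const: "p_var p (\<lambda>_. c) = 0"
  unfolding p_var_def by (auto simp: SUP_constant bot_ennreal intro!: antisym SUP_least)

lemma period_partition_strict_mono_on:
  assumes "period_partition n x"
  shows "strict_mono_on {..n} x"
proof (rule strict_mono_onI)
  fix i j assume "i \<in> {..n}" "j \<in> {..n}" "i < j"
  from \<open>i < j\<close> \<open>j \<in> {..n}\<close> show "x i < x j"
  proof (induction j)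
    case (Suc j)
    then have "x j < x (Suc j)"
      using assms by (simp add: period_partition_def)
    with Suc show ?case
      by (cases "i = j") auto
  qed simp
qed

lemma sum_of_bool_le_1:
  fixes P :: "'a \<Rightarrow> bool"
  assumes "finite A" and unique: "\<And>i j. i \<in> A \<Longrightarrow> j \<in> A \<Longrightarrow> P i \<Longrightarrow> P j \<Longrightarrow> i = j"
  shows "(\<Sum>i\<in>A. of_bool (P i)) \<le> (1 :: real)"
proof -
  have "card (A \<inter> {i. P i}) \<le> 1"
    using assms by (auto simp: card_le_Suc0_iff_eq)
  then show ?thesis
    using \<open>finite A\<close> by (simp add: sum_of_bool_eq)
qed

text \<open>Neither the left nor the right endpoints of the intervals of a period partition can contain
  two integers, since they lie in a half-open interval of length \<open>1\<close>. As the differences of an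
  indicator function are bounded by the sum of the two values, the sums of \<open>p\<close>-th powers are
  at most \<open>2\<close>.\<close>

lemma p_var_indicator_Ints_finite:
  assumes "1 \<le> p"
  shows "p_var p (\<lambda>t. of_bool (t \<in> \<int>)) < \<infinity>"
proof -
  define h :: "real \<Rightarrow> real" where "h = (\<lambda>t. of_bool (t \<in> \<int>))"
  have "(\<Sum>k<n. \<bar>h (x (Suc k)) - h (x k)\<bar> powr p) \<le> 2" if part: "period_partition n x" for n x
  proof -
    note mono = period_partition_strict_mono_on[OF part]
    have last: "x n = x 0 + 1"
      using part by (simp add: period_partition_def)
    have close: "i = j" if "i \<le> n" "j \<le> n" "x i \<in> \<int>" "x j \<in> \<int>" "\<bar>x i - x j\<bar> < 1" for i j
    proof -
      have "x i = x j"
        using that Ints_eq_abs_less1 by blast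
      then show ?thesis
        using strict_mono_on_eqD[OF mono] that by auto
    qed
    have lo: "x 0 < x k" if "0 < k" "k \<le> n" for k
      using strict_mono_onD[OF mono, of 0 k] that by simp
    have hi: "x k < x n" if "k < n" for k
      using strict_mono_onD[OF mono, of k n] that by simp
    have lo': "x 0 \<le> x k" if "k \<le> n" for k
      using lo[of k] that by (cases "k = 0") auto
    have hi': "x k \<le> x n" if "k \<le> n" for k
      using hi[of k] that by (cases "k = n") auto
    have right: "(\<Sum>k<n. h (x (Suc k))) \<le> 1"
      unfolding h_def
    proof (rule sum_of_bool_le_1)
      fix i j assume *: "i \<in> {..<n}" "j \<in> {..<n}" "x (Suc i) \<in> \<int>" "x (Suc j) \<in> \<int>"
      have "\<bar>x (Suc i) - x (Suc j)\<bar> < 1"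
        using lo[of "Suc i"] lo[of "Suc j"] hi'[of "Suc i"] hi'[of "Suc j"] last * by auto
      then show "i = j"
        using close[of "Suc i" "Suc j"] * by auto
    qed simp
    have left: "(\<Sum>k<n. h (x k)) \<le> 1"
      unfolding h_def
    proof (rule sum_of_bool_le_1)
      fix i j assume *: "i \<in> {..<n}" "j \<in> {..<n}" "x i \<in> \<int>" "x j \<in> \<int>"
      have "\<bar>x i - x j\<bar> < 1"
        using lo'[of i] lo'[of j] hi[of i] hi[of j] last * by auto
      then show "i = j"
        using close[of i j] * by auto
    qed simp
    have "(\<Sum>k<n. \<bar>h (x (Suc k)) - h (x k)\<bar> powr p) \<le> (\<Sum>k<n. h (x (Suc k)) + h (x k))"
      by (rule sum_mono) (auto simp: h_def)
    also have "\<dots> \<le> 2"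
      using right left by (simp add: sum.distrib)
    finally show ?thesis .
  qed
  then have "p_var p h \<le> ennreal (2 powr (1 / p))"
    unfolding p_var_def using assms
    by (auto intro!: SUP_least ennreal_leI powr_mono2 sum_nonneg)
  then show ?thesis
    unfolding h_def using ennreal_less_top le_less_trans by fastforce
qed

definition diag_indicator :: "real \<Rightarrow> real \<Rightarrow> real" where
  "diag_indicator x y = of_bool (x - y \<in> \<int>)"

lemma diag_indicator_commute: "diag_indicator x y = diag_indicator y x"
  using minus_in_Ints_iff[of "x - y"] by (simp add: diag_indicator_def)

lemma periodic2_diag_indicator: "periodic2 diag_indicator"
proof -
  have "x + 1 - y \<in> \<int> \<longleftrightarrow> x - y \<in> \<int>" for x y :: real
    by (metis Ints_1 Ints_add Ints_diff add_diff_cancel_right' diff_add_eq)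
  then have "diag_indicator (x + 1) y = diag_indicator x y" for x y
    by (simp add: diag_indicator_def)
  then show ?thesis
    unfolding periodic2_def by (metis diag_indicator_commute)
qed

lemma p_var_diag_indicator_section:
  "p_var p (\<lambda>x. diag_indicator x y) = p_var p (\<lambda>t. of_bool (t \<in> \<int>))"
  unfolding diag_indicator_def
  using p_var_translate[of p "\<lambda>t. of_bool (t \<in> \<int>)" "- y"] by simp

lemma diag_indicator_in_VV_space:
  assumes "1 \<le> p"
  shows "diag_indicator \<in> VV_space p"
proof -
  have section': "p_var p (diag_indicator x) = p_var p (\<lambda>t. of_bool (t \<in> \<int>))" for x
    using p_var_diag_indicator_section[of p x] by (simp add: diag_indicator_commute[of _ x])
  have "p_var p (phi_var p diag_indicator) = 0" "p_var p (psi_var p diag_indicator) = 0"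
    unfolding phi_var_def psi_var_def section' p_var_diag_indicator_section
    by (rule p_var_const)+
  then show ?thesis
    using p_var_indicator_Ints_finite[OF assms]
    by (simp add: VV_space_def periodic2_diag_indicator section' p_var_diag_indicator_section)
qed

text \<open>Only the \<open>N\<close> diagonal cells of the uniform net are used. The off-diagonal corners of
  such a cell differ by \<open>1 / N\<close>, which is not an integer once \<open>N \<ge> 2\<close>.\<close>

lemma p_var2_diag_indicator_ge:
  assumes "1 \<le> p" "2 \<le> N"
  shows "ennreal (real N powr (1 / p)) \<le> p_var2 p diag_indicator"
proof -
  define x :: "nat \<Rightarrow> real" where "x = (\<lambda>k. real k / real N)"
  have part: "period_partition N x"
    using assms by (auto simp: period_partition_def x_def divide_strict_right_mono)
  define D where "D i j = \<bar>diag_indicator (x (Suc i)) (x (Suc j)) - diag_indicator (x (Suc i)) (x j)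
      - diag_indicator (x i) (x (Suc j)) + diag_indicator (x i) (x j)\<bar> powr p" for i j
  have one_le: "1 \<le> D i i" for i
  proof -
    have "x (Suc i) - x i = 1 / real N"
      by (simp add: x_def diff_divide_distrib[symmetric])
    moreover have "1 / real N \<notin> \<int>"
      using assms(2) Ints_nonzero_abs_less1[of "1 / real N"] by auto
    ultimately have "diag_indicator (x (Suc i)) (x i) = 0"
      by (simp add: diag_indicator_def)
    moreover have "diag_indicator t t = 1" for t
      by (simp add: diag_indicator_def)
    ultimately have "D i i = 2 powr p"
      unfolding D_def by (simp add: diag_indicator_commute[of "x i" "x (Suc i)"])
    then show ?thesis
      using assms(1) by (simp add: ge_one_powr_ge_zero)
  qed
  have "real N = (\<Sum>i<N. 1)"
    by simp
  also have "\<dots> \<le> (\<Sum>i<N. \<Sum>j<N. D i j)"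
  proof (rule sum_mono)
    fix i assume "i \<in> {..<N}"
    then have "D i i \<le> (\<Sum>j<N. D i j)"
      by (intro member_le_sum) (auto simp: D_def)
    then show "1 \<le> (\<Sum>j<N. D i j)"
      using one_le[of i] by linarith
  qed
  finally have "ennreal (real N powr (1 / p)) \<le> ennreal ((\<Sum>i<N. \<Sum>j<N. D i j) powr (1 / p))"
    using assms(1) by (intro ennreal_leI powr_mono2) auto
  also have "\<dots> \<le> p_var2 p diag_indicator"
    unfolding p_var2_def D_def using part
    by (intro SUP_upper2[of "(N, x, N, x)"]) auto
  finally show ?thesis .
qed

lemma p_var2_diag_indicator:
  assumes "1 \<le> p"
  shows "p_var2 p diag_indicator = \<infinity>"
proof (rule ccontr)
  assume "p_var2 p diag_indicator \<noteq> \<infinity>"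
  then obtain B where B: "0 \<le> B" "p_var2 p diag_indicator = ennreal B"
    by (cases "p_var2 p diag_indicator") auto
  obtain N0 :: nat where N0: "B powr p < real N0"
    using reals_Archimedean2 by blast
  define N where "N = N0 + 2"
  have "real N powr (1 / p) \<le> B"
    using p_var2_diag_indicator_ge[OF assms, of N] B by (simp add: N_def)
  then have "(real N powr (1 / p)) powr p \<le> B powr p"
    using assms by (intro powr_mono2) auto
  then have "real N \<le> B powr p"
    using assms by (simp add: powr_powr)
  with N0 show False
    by (simp add: N_def)
qed

theorem proposition5p2:
  fixes p :: real
  assumes "1 \<le> p"
  shows "\<exists>f. f \<in> VV_space p \<and> f \<notin> H2_space p"
  using diag_indicator_in_VV_space[OF assms] p_var2_diag_indicator[OF assms]
  by (auto simp: H2_space_def)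

end
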